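(* Let $G=(V,E)$ be an infinite, connected, locally finite, simple undirected graph with girth at least $6$, let $\kappa^*:E\to\mathbb{R}$ be any function, and let $\omega_0:E\to(0,\infty)$ be any positive function. Then the solution of the Ricci flow $$\frac{d}{dt}\omega(t,e)=-(\kappa(t,e)-\kappa^*(e))\,\omega(t,e),\qquad t>0,\ e\in E,$$ with initial value $\omega(0,\cdot)=\omega_0$ is unique; that is, any two solutions with this initial value coincide on every edge for all times.
   Context: The girth of $G$ is the length of a shortest cycle ($\infty$ if there is none). $\kappa(t,e)$ denotes the Lin-Lu-Yau curvature of the edge $e$ for the positive edge weights $\omega(t,\cdot)$; on a graph of girth at least $6$ it is given, for $e=(x,y)$ and positive edge weights $\omega$, by $\kappa_e=2\omega_{xy}\left(\frac1{m(x)}+\frac1{m(y)}\right)-2$, where $m(x)=\sum_{u\sim x}\omega_{xu}$. A solution is a family of positive functions $\omega(\cdot,e)$, $e\in E$, continuous on $[0,\infty)$ and continuously differentiable on $(0,\infty)$, satisfying the equation for $t>0$ and the initial condition at $t=0$. *)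

theory Defs
  imports "HOL-Probability.Probability"
begin

section \<open>Graphs\<close>

text \<open>A simple undirected graph is a vertex set \<open>V\<close> with a set \<open>E\<close> of two-element subsets
  of \<open>V\<close>. Notions depending only on adjacency take just \<open>E\<close> as argument.\<close>

definition simple_graph :: "'a set \<Rightarrow> 'a set set \<Rightarrow> bool" where
  "simple_graph V E \<longleftrightarrow> (\<forall>e\<in>E. \<exists>x\<in>V. \<exists>y\<in>V. x \<noteq> y \<and> e = {x, y})"

definition neighbours :: "'a set set \<Rightarrow> 'a \<Rightarrow> 'a set" where
  "neighbours E x = {u. {x, u} \<in> E}"

definition locally_finite_graph :: "'a set \<Rightarrow> 'a set set \<Rightarrow> bool" where
  "locally_finite_graph V E \<longleftrightarrow> (\<forall>x\<in>V. finite (neighbours E x))"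

text \<open>Walks are given by their nonempty vertex lists; a walk \<open>p\<close> has \<open>length p - 1\<close> edges.\<close>

definition walk_between :: "'a set set \<Rightarrow> 'a \<Rightarrow> 'a list \<Rightarrow> 'a \<Rightarrow> bool" where
  "walk_between E x p y \<longleftrightarrow>
     p \<noteq> [] \<and> hd p = x \<and> last p = y \<and> successively (\<lambda>u v. {u, v} \<in> E) p"

definition connected_graph :: "'a set \<Rightarrow> 'a set set \<Rightarrow> bool" where
  "connected_graph V E \<longleftrightarrow> (\<forall>x\<in>V. \<forall>y\<in>V. \<exists>p. walk_between E x p y)"

definition graph_dist :: "'a set set \<Rightarrow> 'a \<Rightarrow> 'a \<Rightarrow> nat" where
  "graph_dist E x y = (LEAST n. \<exists>p. walk_between E x p y \<and> length p = Suc n)"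

text \<open>A cycle is listed without repeating its starting vertex, so its number of edges is the
  length of the list.\<close>

definition graph_cycle :: "'a set set \<Rightarrow> 'a list \<Rightarrow> bool" where
  "graph_cycle E c \<longleftrightarrow>
     3 \<le> length c \<and> distinct c \<and> successively (\<lambda>u v. {u, v} \<in> E) c \<and> {last c, hd c} \<in> E"

definition girth :: "'a set set \<Rightarrow> enat" where
  "girth E = (INF c \<in> {c. graph_cycle E c}. enat (length c))"


section \<open>Lin-Lu-Yau curvature\<close>

definition vertex_weight :: "'a set set \<Rightarrow> ('a set \<Rightarrow> real) \<Rightarrow> 'a \<Rightarrow> real" where
  "vertex_weight E w x = (\<Sum>u\<in>neighbours E x. w {x, u})"

text \<open>One step of the random walk from \<open>x\<close> with idleness \<open>\<alpha>\<close>: the walk stays at \<open>x\<close> with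
  probability \<open>\<alpha>\<close> and moves to a neighbour \<open>u\<close> with probability \<open>(1 - \<alpha>) w\<^sub>x\<^sub>u / m(x)\<close>.
  This is a probability distribution (so that \<^const>\<open>embed_pmf\<close> is meaningful) when
  \<open>0 \<le> \<alpha> \<le> 1\<close>, \<open>w\<close> is positive on \<open>E\<close>, and \<open>x\<close> is not incident to itself and has a
  nonempty finite set of neighbours.\<close>

definition lazy_walk :: "'a set set \<Rightarrow> ('a set \<Rightarrow> real) \<Rightarrow> real \<Rightarrow> 'a \<Rightarrow> 'a pmf" where
  "lazy_walk E w \<alpha> x = embed_pmf (\<lambda>z.
     if z = x then \<alpha>
     else if z \<in> neighbours E x then (1 - \<alpha>) * w {x, z} / vertex_weight E w x
     else 0)"

definition couplings :: "'a pmf \<Rightarrow> 'a pmf \<Rightarrow> ('a \<times> 'a) pmf set" where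
  "couplings \<mu> \<nu> = {\<pi>. map_pmf fst \<pi> = \<mu> \<and> map_pmf snd \<pi> = \<nu>}"

text \<open>The transport distance is used only for finitely supported distributions, where all
  the expectations exist.\<close>

definition wasserstein :: "('a \<Rightarrow> 'a \<Rightarrow> real) \<Rightarrow> 'a pmf \<Rightarrow> 'a pmf \<Rightarrow> real" where
  "wasserstein d \<mu> \<nu> =
     (INF \<pi> \<in> couplings \<mu> \<nu>. measure_pmf.expectation \<pi> (\<lambda>(u, v). d u v))"

definition ollivier_curvature ::
  "'a set set \<Rightarrow> ('a set \<Rightarrow> real) \<Rightarrow> real \<Rightarrow> 'a \<Rightarrow> 'a \<Rightarrow> real" where
  "ollivier_curvature E w \<alpha> x y =
     1 - wasserstein (\<lambda>u v. real (graph_dist E u v)) (lazy_walk E w \<alpha> x) (lazy_walk E w \<alpha> y)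
           / real (graph_dist E x y)"

text \<open>Distances are combinatorial; the edge weights enter through the random walk only. For an
  edge \<open>{x, y}\<close> of a graph of girth at least 6 this yields
  \<open>2 w\<^sub>x\<^sub>y (1 / m(x) + 1 / m(y)) - 2\<close>.\<close>

definition lly_curvature :: "'a set set \<Rightarrow> ('a set \<Rightarrow> real) \<Rightarrow> 'a \<Rightarrow> 'a \<Rightarrow> real" where
  "lly_curvature E w x y = Lim (at_left 1) (\<lambda>\<alpha>. ollivier_curvature E w \<alpha> x y / (1 - \<alpha>))"


section \<open>The Ricci flow\<close>

text \<open>The curvature is symmetric in the endpoints of an edge, so imposing the equation for
  both orderings of the endpoints imposes it once per edge.\<close>

definition ricci_flow_solution ::
  "'a set set \<Rightarrow> ('a set \<Rightarrow> real) \<Rightarrow> ('a set \<Rightarrow> real) \<Rightarrow> (real \<Rightarrow> 'a set \<Rightarrow> real) \<Rightarrow> bool" where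
  "ricci_flow_solution E \<kappa>s \<omega>0 \<omega> \<longleftrightarrow>
     (\<forall>e\<in>E.
        (\<forall>t\<ge>0. 0 < \<omega> t e) \<and>
        continuous_on {0..} (\<lambda>t. \<omega> t e) \<and>
        (\<lambda>t. \<omega> t e) C1_differentiable_on {0<..} \<and>
        \<omega> 0 e = \<omega>0 e) \<and>
     (\<forall>x y. {x, y} \<in> E \<longrightarrow>
        (\<forall>t>0. ((\<lambda>s. \<omega> s {x, y}) has_real_derivative
                  - (lly_curvature E (\<omega> t) x y - \<kappa>s {x, y}) * \<omega> t {x, y}) (at t)))"

end

theory Submission
  imports Defs
begin

text \<open>For an edge \<open>{x, y}\<close> of a graph of girth at least 6, write \<open>p\<close> and \<open>q\<close> for the one-step
  probabilities from \<open>x\<close> to \<open>y\<close> and back. Kantorovich duality gives the curvature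
  \<open>2 (p + q) - 2\<close>, so the logarithm of an edge weight has derivative \<open>\<kappa>s + 2 - 2 (p + q)\<close>.
  Hence the difference of the logarithms of two solutions has derivative at most 4 in absolute
  value on every edge. Moreover, if the logarithms of two weights differ by at most \<open>\<delta>\<close> everywhere,
  the probabilities differ by at most \<open>2 \<delta>\<close>, whatever the vertex degrees. The differences are
  therefore uniformly bounded on \<open>[0, T]\<close> and satisfy a Gronwall inequality in the supremum norm
  over the infinite edge set.\<close>

section \<open>Transport between finitely supported distributions\<close>

lemma pmf_embed_pmf_finite:
  fixes f :: "'a \<Rightarrow> real"
  assumes "finite A" and nonneg: "\<And>z. 0 \<le> f z" and zero: "\<And>z. z \<notin> A \<Longrightarrow> f z = 0"
    and "sum f A = 1"
  shows "pmf (embed_pmf f) z = f z"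
proof (rule pmf_embed_pmf[OF nonneg])
  have "(\<integral>\<^sup>+ z. ennreal (f z) \<partial>count_space UNIV) = (\<Sum>z\<in>A. ennreal (f z))"
    by (rule nn_integral_count_space') (use assms in auto)
  also have "\<dots> = 1"
    using assms by (simp add: sum_ennreal)
  finally show "(\<integral>\<^sup>+ z. ennreal (f z) \<partial>count_space UNIV) = 1" .
qed

text \<open>The integrand \<open>f u - f v\<close> sees only the two marginals, so its expectation
  is the same under every coupling; this is what turns a potential into a lower bound for the
  transport cost. Finite marginals force finite support, which settles integrability.\<close>

lemma expectation_coupling_diff:
  fixes f :: "'a \<Rightarrow> real"
  assumes "\<pi> \<in> couplings \<mu> \<nu>" and fin: "finite (set_pmf \<mu>)" "finite (set_pmf \<nu>)"
  shows "measure_pmf.expectation \<pi> (\<lambda>(u, v). f u - f v) =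
    measure_pmf.expectation \<mu> f - measure_pmf.expectation \<nu> f"
    and "finite (set_pmf \<pi>)"
    and "set_pmf \<pi> \<subseteq> set_pmf \<mu> \<times> set_pmf \<nu>"
proof -
  have \<mu>: "\<mu> = map_pmf fst \<pi>" and \<nu>: "\<nu> = map_pmf snd \<pi>"
    using assms(1) by (auto simp: couplings_def)
  show sub: "set_pmf \<pi> \<subseteq> set_pmf \<mu> \<times> set_pmf \<nu>"
    unfolding \<mu> \<nu> by (force simp: set_map_pmf)
  then show fin': "finite (set_pmf \<pi>)"
    using fin finite_subset by blast
  show "measure_pmf.expectation \<pi> (\<lambda>(u, v). f u - f v) =
    measure_pmf.expectation \<mu> f - measure_pmf.expectation \<nu> f"
    unfolding \<mu> \<nu> integral_map_pmf case_prod_beta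
    by (rule Bochner_Integration.integral_diff) (rule integrable_measure_pmf_finite[OF fin'])+
qed

text \<open>The mass of \<open>\<mu>\<close> at \<open>y\<close> stays put; all other mass is
  spread, independently of where it starts, over what remains of \<open>\<nu>\<close> once that
  amount has been removed at \<open>y\<close>.\<close>

lemma coupling_fixing_point:
  assumes fin: "finite (set_pmf \<nu>)" and le: "pmf \<mu> y \<le> pmf \<nu> y" and lt: "pmf \<mu> y < 1"
  obtains \<pi> where "\<pi> \<in> couplings \<mu> \<nu>" "\<And>b. (y, b) \<in> set_pmf \<pi> \<Longrightarrow> b = y"
proof -
  define c where "c = pmf \<mu> y"
  have c: "0 \<le> c" "c < 1" "c \<le> pmf \<nu> y"
    using le lt by (auto simp: c_def)
  \<comment> \<open>The normalised remainder of \<open>\<nu>\<close>: nonnegative because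
    \<open>c \<le> pmf \<nu> y\<close>, and of total mass 1 after division by
    \<open>1 - c\<close>.\<close>
  define r where "r z = (pmf \<nu> z - (if z = y then c else 0)) / (1 - c)" for z
  define \<rho> where "\<rho> = embed_pmf r"
  have \<rho>: "pmf \<rho> z = r z" for z
    unfolding \<rho>_def
  proof (rule pmf_embed_pmf_finite[where A = "insert y (set_pmf \<nu>)"])
    show "sum r (insert y (set_pmf \<nu>)) = 1"
    proof -
      have "sum (pmf \<nu>) (insert y (set_pmf \<nu>)) = 1"
        by (rule sum_pmf_eq_1) (use fin in auto)
      then show ?thesis
        using fin c unfolding r_def
        by (simp add: sum_divide_distrib[symmetric] sum_subtractf del: sum.insert_if)
    qed
  qed (use fin c in \<open>auto simp: r_def set_pmf_iff\<close>)
  define K where "K a = (if a = y then return_pmf y else \<rho>)" for a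
  define \<pi> where "\<pi> = bind_pmf \<mu> (\<lambda>a. map_pmf (Pair a) (K a))"
  have "map_pmf fst \<pi> = \<mu>"
    by (simp add: \<pi>_def map_bind_pmf pmf.map_comp o_def map_pmf_const bind_return_pmf')
  moreover have "map_pmf snd \<pi> = \<nu>"
  proof (rule pmf_eqI)
    fix z
    have "map_pmf snd \<pi> = bind_pmf \<mu> K"
      by (simp add: \<pi>_def map_bind_pmf pmf.map_comp o_def)
    then have "pmf (map_pmf snd \<pi>) z = measure_pmf.expectation \<mu> (\<lambda>a. pmf (K a) z)"
      by (simp add: pmf_bind)
    \<comment> \<open>The kernel \<open>K\<close> takes only two values, so it is affine in the
      indicator of \<open>y\<close>, whose expectation under \<open>\<mu>\<close> is
      \<open>c\<close>.\<close>
    also have "(\<lambda>a. pmf (K a) z) =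
        (\<lambda>a. pmf \<rho> z + (pmf (return_pmf y) z - pmf \<rho> z) * indicator {y} a)"
      by (auto simp: K_def fun_eq_iff)
    also have "measure_pmf.expectation \<mu> \<dots> = pmf \<rho> z + (pmf (return_pmf y) z - pmf \<rho> z) * c"
      by (subst Bochner_Integration.integral_add) (auto simp: c_def measure_pmf_single intro: measure_pmf.integrable_const_bound[where B = 1])
    also have "\<dots> = pmf \<nu> z"
    proof -
      have "r z * (1 - c) = pmf \<nu> z - (if z = y then c else 0)"
        using c by (simp add: r_def)
      then show ?thesis
        by (auto simp: \<rho> algebra_simps split: split_indicator)
    qed
    finally show "pmf (map_pmf snd \<pi>) z = pmf \<nu> z" .
  qed
  moreover have "b = y" if "(y, b) \<in> set_pmf \<pi>" for b
    using that by (auto simp: \<pi>_def K_def split: if_splits)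
  ultimately show thesis
    using that by (simp add: couplings_def)
qed

text \<open>Kantorovich duality with an explicit potential: \<open>f\<close> is tight on all pairs except those
  starting at \<open>y\<close>, and the mass of \<open>y\<close> can stay where it is.\<close>

lemma wasserstein_eq_potential:
  fixes f :: "'a \<Rightarrow> real"
  assumes fin: "finite (set_pmf \<mu>)" "finite (set_pmf \<nu>)"
    and mass: "pmf \<mu> y \<le> pmf \<nu> y" "pmf \<mu> y < 1"
    and tight: "\<And>a b. a \<in> set_pmf \<mu> \<Longrightarrow> b \<in> set_pmf \<nu> \<Longrightarrow> a \<noteq> y \<Longrightarrow> d a b = f a - f b"
    and below: "\<And>b. b \<in> set_pmf \<nu> \<Longrightarrow> f y - f b \<le> d y b"
    and refl: "d y y = 0"
  shows "wasserstein d \<mu> \<nu> = measure_pmf.expectation \<mu> f - measure_pmf.expectation \<nu> f"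
proof -
  let ?W = "measure_pmf.expectation \<mu> f - measure_pmf.expectation \<nu> f"
  let ?cost = "\<lambda>\<pi>. measure_pmf.expectation \<pi> (\<lambda>(u, v). d u v)"
  have lower: "?W \<le> ?cost \<pi>" if \<pi>: "\<pi> \<in> couplings \<mu> \<nu>" for \<pi>
  proof -
    note C = expectation_coupling_diff[OF \<pi> fin]
    have "measure_pmf.expectation \<pi> (\<lambda>(u, v). f u - f v) \<le> ?cost \<pi>"
    proof (rule integral_mono_AE)
      show "AE z in measure_pmf \<pi>. (case z of (u, v) \<Rightarrow> f u - f v) \<le> (case z of (u, v) \<Rightarrow> d u v)"
        using C(3) tight below by (fastforce simp: AE_measure_pmf_iff)
    qed (rule integrable_measure_pmf_finite[OF C(2)])+
    then show ?thesis
      by (simp add: C(1))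
  qed
  obtain \<pi> where \<pi>: "\<pi> \<in> couplings \<mu> \<nu>" and stay: "\<And>b. (y, b) \<in> set_pmf \<pi> \<Longrightarrow> b = y"
    using coupling_fixing_point[OF fin(2) mass] by blast
  note C = expectation_coupling_diff[OF \<pi> fin]
  have "?cost \<pi> = measure_pmf.expectation \<pi> (\<lambda>(u, v). f u - f v)"
  proof (rule integral_cong_AE)
    show "AE z in measure_pmf \<pi>. (case z of (u, v) \<Rightarrow> d u v) = (case z of (u, v) \<Rightarrow> f u - f v)"
    proof (clarsimp simp: AE_measure_pmf_iff)
      fix u v assume "(u, v) \<in> set_pmf \<pi>"
      then show "d u v = f u - f v"
        using C(3) tight refl stay[of v] by (cases "u = y") auto
    qed
  qed auto
  then have "?cost \<pi> = ?W"
    by (simp add: C(1))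
  then show ?thesis
    unfolding wasserstein_def
    by (intro cInf_eq_minimum) (use \<pi> lower in force)+
qed

section \<open>Curvature on graphs of girth at least 6\<close>

lemma graph_cycle_length:
  assumes "girth E \<ge> 6" "graph_cycle E c"
  shows "6 \<le> length c"
proof -
  have "girth E \<le> enat (length c)"
    unfolding girth_def by (rule INF_lower) (use assms in simp)
  then show ?thesis
    using assms(1) by (metis enat_ord_simps(1) numeral_eq_enat order_trans)
qed

section \<open>Bounds on the combinatorial distance\<close>

lemma graph_dist_le:
  assumes "walk_between E a p b"
  shows "graph_dist E a b \<le> length p - 1"
  unfolding graph_dist_def
  by (rule Least_le) (use assms in \<open>auto simp: walk_between_def intro!: exI[of _ p]\<close>)

text \<open>A \<open>LEAST\<close> is attained only if some candidate exists. The lower bounds on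
  \<open>graph_dist\<close> below therefore all assume a walk, and exclude short walks by listing
  their vertices.\<close>

lemma shortest_walk:
  assumes "walk_between E a p b"
  obtains q where "walk_between E a q b" "length q = Suc (graph_dist E a b)"
proof -
  have "\<exists>p. walk_between E a p b \<and> length p = Suc (length p - 1)"
    using assms by (auto simp: walk_between_def intro!: exI[of _ p])
  then have "\<exists>n q. walk_between E a q b \<and> length q = Suc n"
    by blast
  then show thesis
    using that LeastI_ex[of "\<lambda>n. \<exists>q. walk_between E a q b \<and> length q = Suc n"]
    unfolding graph_dist_def by blast
qed

lemma graph_dist_self: "graph_dist E a a = 0"
  using graph_dist_le[of E a "[a]" a] by (simp add: walk_between_def)

lemma graph_dist_pos:
  assumes "walk_between E a p b" "a \<noteq> b"
  shows "1 \<le> graph_dist E a b"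
proof (rule ccontr)
  assume "\<not> ?thesis"
  then obtain q where "walk_between E a q b" "length q = 1"
    using shortest_walk[OF assms(1)] by (metis One_nat_def less_one not_le)
  then show False
    using assms(2) by (auto simp: walk_between_def length_Suc_conv)
qed

lemma graph_dist_ge_2:
  assumes "walk_between E a p b" "a \<noteq> b" "{a, b} \<notin> E"
  shows "2 \<le> graph_dist E a b"
proof (rule ccontr)
  assume "\<not> ?thesis"
  then have "graph_dist E a b = 1"
    using graph_dist_pos[OF assms(1,2)] by simp
  then obtain q where "walk_between E a q b" "length q = 2"
    using shortest_walk[OF assms(1)] by (metis Suc_1)
  then show False
    using assms(3) by (auto simp: walk_between_def length_Suc_conv numeral_2_eq_2)
qed

lemma graph_dist_ge_3:
  assumes "walk_between E a p b" "a \<noteq> b" "{a, b} \<notin> E" "\<And>z. {a, z} \<in> E \<Longrightarrow> {z, b} \<notin> E"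
  shows "3 \<le> graph_dist E a b"
proof (rule ccontr)
  assume "\<not> ?thesis"
  then have "graph_dist E a b = 2"
    using graph_dist_ge_2[OF assms(1-3)] by simp
  then obtain q where "walk_between E a q b" "length q = 3"
    using shortest_walk[OF assms(1)] by (metis eval_nat_numeral(3))
  then show False
    using assms(4) by (auto simp: walk_between_def length_Suc_conv numeral_3_eq_3)
qed

text \<open>The transition probability of the walk without idleness. Since \<open>w {x, y}\<close>
  is symmetric, the sum over both directions of an edge is the weight times
  \<open>1 / m(x) + 1 / m(y)\<close>, the quantity in the curvature formula.\<close>

definition walk_prob :: "'a set set \<Rightarrow> ('a set \<Rightarrow> real) \<Rightarrow> 'a \<Rightarrow> 'a \<Rightarrow> real" where
  "walk_prob E w x y = w {x, y} / vertex_weight E w x"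

lemma vertex_weight_ge:
  assumes "finite (neighbours E x)" "\<And>e. e \<in> E \<Longrightarrow> 0 < w e" "{x, y} \<in> E"
  shows "w {x, y} \<le> vertex_weight E w x"
  unfolding vertex_weight_def
  by (rule member_le_sum) (use assms in \<open>auto simp: neighbours_def less_imp_le\<close>)

lemma walk_prob_bounds:
  assumes "finite (neighbours E x)" "\<And>e. e \<in> E \<Longrightarrow> 0 < w e" "{x, y} \<in> E"
  shows "0 < vertex_weight E w x" "0 < walk_prob E w x y" "walk_prob E w x y \<le> 1"
proof -
  have "0 < w {x, y}" "w {x, y} \<le> vertex_weight E w x"
    using assms(2,3) vertex_weight_ge[OF assms] by auto
  then show "0 < vertex_weight E w x" "0 < walk_prob E w x y" "walk_prob E w x y \<le> 1"
    by (auto simp: walk_prob_def)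
qed

lemma sum_walk_prob:
  assumes "vertex_weight E w x \<noteq> 0"
  shows "(\<Sum>u\<in>neighbours E x. walk_prob E w x u) = 1"
  using assms by (simp add: walk_prob_def sum_divide_distrib[symmetric] vertex_weight_def)

text \<open>The edge at \<open>x\<close> makes the total weight positive, and the absence of a loop
  keeps the idle mass apart from the mass sent to neighbours, so the masses add up to 1 and
  \<open>embed_pmf\<close> returns the intended distribution.\<close>

lemma lazy_walk:
  assumes fin: "finite (neighbours E x)" and pos: "\<And>e. e \<in> E \<Longrightarrow> 0 < w e"
    and edge: "{x, y} \<in> E" and loop: "{x} \<notin> E" and \<alpha>: "0 \<le> \<alpha>" "\<alpha> \<le> 1"
  shows "pmf (lazy_walk E w \<alpha> x) z =
      (if z = x then \<alpha> else if z \<in> neighbours E x then (1 - \<alpha>) * walk_prob E w x z else 0)"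
    and "set_pmf (lazy_walk E w \<alpha> x) \<subseteq> insert x (neighbours E x)"
    and "measure_pmf.expectation (lazy_walk E w \<alpha> x) f =
      \<alpha> * f x + (1 - \<alpha>) * (\<Sum>u\<in>neighbours E x. walk_prob E w x u * f u)"
proof -
  let ?N = "neighbours E x"
  let ?g = "\<lambda>z. if z = x then \<alpha> else if z \<in> ?N then (1 - \<alpha>) * walk_prob E w x z else 0"
  have notin: "x \<notin> ?N"
    using loop by (simp add: neighbours_def)
  have sum_g: "(\<Sum>z\<in>insert x ?N. ?g z * h z) =
      \<alpha> * h x + (1 - \<alpha>) * (\<Sum>u\<in>?N. walk_prob E w x u * h u)" for h
  proof -
    have "(\<Sum>z\<in>?N. ?g z * h z) = (\<Sum>z\<in>?N. (1 - \<alpha>) * (walk_prob E w x z * h z))"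
      by (rule sum.cong) (use notin in auto)
    then show ?thesis
      using fin notin by (simp add: sum_distrib_left)
  qed
  have "lazy_walk E w \<alpha> x = embed_pmf ?g"
    unfolding lazy_walk_def walk_prob_def times_divide_eq_right ..
  moreover have "pmf (embed_pmf ?g) z = ?g z" for z
  proof (rule pmf_embed_pmf_finite[where A = "insert x ?N"])
    show "sum ?g (insert x ?N) = 1"
      using sum_g[of "\<lambda>_. 1"] walk_prob_bounds(1)[where w = w, OF fin pos edge] by (simp add: sum_walk_prob)
    show "0 \<le> ?g z" for z
      using \<alpha> walk_prob_bounds(2)[where w = w, OF fin pos, of z] by (auto simp: neighbours_def less_imp_le)
  qed (use fin in auto)
  ultimately show pmf: "pmf (lazy_walk E w \<alpha> x) z = ?g z" for z
    by simp
  then show sub: "set_pmf (lazy_walk E w \<alpha> x) \<subseteq> insert x ?N"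
    by (auto simp: set_pmf_iff split: if_splits)
  have "measure_pmf.expectation (lazy_walk E w \<alpha> x) f = (\<Sum>z\<in>insert x ?N. ?g z * f z)"
    by (subst integral_measure_pmf[of "insert x ?N"]) (use fin sub in \<open>auto simp: pmf\<close>)
  then show "measure_pmf.expectation (lazy_walk E w \<alpha> x) f =
      \<alpha> * f x + (1 - \<alpha>) * (\<Sum>u\<in>?N. walk_prob E w x u * f u)"
    by (simp only: sum_g)
qed

section \<open>Distances and curvature around a single edge\<close>

locale girth_6_edge =
  fixes E :: "'a set set" and x y :: 'a
  assumes girth: "girth E \<ge> 6"
    and loops: "{z} \<notin> E"
    and edge: "{x, y} \<in> E"
begin

lemma neq: "x \<noteq> y"
  using edge loops by auto

lemma no_triangle: "{x, z} \<in> E \<Longrightarrow> {y, z} \<notin> E"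
proof
  assume "{x, z} \<in> E" "{y, z} \<in> E"
  then have "graph_cycle E [x, y, z]"
    using edge loops by (auto simp: graph_cycle_def insert_commute)
  then show False
    using graph_cycle_length[OF girth] by fastforce
qed

lemma dist_1: "{a, b} \<in> E \<Longrightarrow> graph_dist E a b = 1"
proof -
  assume *: "{a, b} \<in> E"
  then have "walk_between E a [a, b] b" "a \<noteq> b"
    using loops by (auto simp: walk_between_def)
  then show ?thesis
    using graph_dist_le[of E a "[a, b]" b] graph_dist_pos[of E a "[a, b]" b] by simp
qed

lemma dist_2: "{y, v} \<in> E \<Longrightarrow> v \<noteq> x \<Longrightarrow> graph_dist E x v = 2"
proof -
  assume *: "{y, v} \<in> E" "v \<noteq> x"
  then have "walk_between E x [x, y, v] v" "{x, v} \<notin> E"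
    using edge no_triangle by (auto simp: walk_between_def)
  then show ?thesis
    using graph_dist_le[of E x "[x, y, v]" v] graph_dist_ge_2[of E x "[x, y, v]" v] *
    by simp
qed

text \<open>The path \<open>u, x, y, v\<close> gives the upper bound. An edge from \<open>u\<close>
  to \<open>v\<close> would close a 4-cycle with it, and a common neighbour of \<open>u\<close> and
  \<open>v\<close> a 5-cycle.\<close>

lemma dist_3:
  assumes u: "{x, u} \<in> E" "u \<noteq> y" and v: "{y, v} \<in> E" "v \<noteq> x"
  shows "graph_dist E u v = 3"
proof -
  have walk: "walk_between E u [u, x, y, v] v"
    using edge u v by (auto simp: walk_between_def insert_commute)
  have nv: "{x, v} \<notin> E" "{y, u} \<notin> E"
    using no_triangle u v by auto
  have neqs: "u \<noteq> x" "v \<noteq> y" "u \<noteq> v"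
    using u v nv loops by auto
  have "{u, v} \<notin> E"
  proof
    assume "{u, v} \<in> E"
    then have "graph_cycle E [u, v, y, x]"
      using u v neqs neq edge by (auto simp: graph_cycle_def insert_commute)
    then show False
      using graph_cycle_length[OF girth] by fastforce
  qed
  moreover have "{z, v} \<notin> E" if "{u, z} \<in> E" for z
  proof
    assume zv: "{z, v} \<in> E"
    have "z \<noteq> x" "z \<noteq> y" "z \<noteq> u" "z \<noteq> v"
      using zv that nv loops by (auto simp: insert_commute)
    then have "graph_cycle E [u, z, v, y, x]"
      using u v neqs neq edge that zv by (auto simp: graph_cycle_def insert_commute)
    then show False
      using graph_cycle_length[OF girth] by fastforce
  qed
  ultimately show ?thesis
    using graph_dist_le[OF walk] graph_dist_ge_3[OF walk] neqs by simp
qed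

lemma girth_6_edge_swap: "girth_6_edge E y x"
  using girth loops edge by unfold_locales (auto simp: insert_commute)

text \<open>An optimal potential takes the values 2, 1, 0, -1 along each path \<open>u, x, y, v\<close>.\<close>

lemma wasserstein_lazy_walk:
  assumes fin: "finite (neighbours E x)" "finite (neighbours E y)"
    and pos: "\<And>e. e \<in> E \<Longrightarrow> 0 < w e" and \<alpha>: "1 / 2 \<le> \<alpha>" "\<alpha> < 1"
  shows "wasserstein (\<lambda>u v. real (graph_dist E u v)) (lazy_walk E w \<alpha> x) (lazy_walk E w \<alpha> y) =
    1 - (1 - \<alpha>) * (2 * (walk_prob E w x y + walk_prob E w y x) - 2)"
proof -
  interpret swap: girth_6_edge E y x
    by (rule girth_6_edge_swap)
  let ?\<mu> = "lazy_walk E w \<alpha> x" and ?\<nu> = "lazy_walk E w \<alpha> y"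
  \<comment> \<open>The default \<open>- 1\<close> is meant for the neighbours of \<open>y\<close>
    other than \<open>x\<close>; as there are no triangles, none of them falls under the earlier
    cases. Vertices further away carry no mass.\<close>
  define f :: "'a \<Rightarrow> real" where
    "f z = (if z = x then 1 else if z = y then 0 else if z \<in> neighbours E x then 2 else - 1)" for z
  have \<alpha>': "0 \<le> \<alpha>" "\<alpha> \<le> 1"
    using \<alpha> by auto
  note Wx = lazy_walk[where w = w, OF fin(1) pos edge loops \<alpha>']
  note Wy = lazy_walk[where w = w, OF fin(2) pos swap.edge loops \<alpha>']
  have fx: "f x = 1" and fy: "f y = 0"
    using neq by (auto simp: f_def)
  have fu: "f u = 2 - 2 * of_bool (u = y)" if "u \<in> neighbours E x" for u
    using that loops neq by (auto simp: f_def neighbours_def)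
  have fv: "f v = 2 * of_bool (v = x) - 1" if "v \<in> neighbours E y" for v
    using that loops neq no_triangle by (auto simp: f_def neighbours_def)
  have px: "0 < walk_prob E w x y" "walk_prob E w x y \<le> 1"
    using walk_prob_bounds[where w = w, OF fin(1) pos edge] by auto
  have le1: "(1 - \<alpha>) * walk_prob E w x y \<le> (1 - \<alpha>) * 1"
    using px \<alpha> by (intro mult_left_mono) auto
  have "wasserstein (\<lambda>u v. real (graph_dist E u v)) ?\<mu> ?\<nu> =
      measure_pmf.expectation ?\<mu> f - measure_pmf.expectation ?\<nu> f"
  proof (rule wasserstein_eq_potential[where y = y])
    show "finite (set_pmf ?\<mu>)" "finite (set_pmf ?\<nu>)"
      using Wx(2) Wy(2) fin by (auto intro: finite_subset)
    \<comment> \<open>Idleness at least 1/2 gives \<open>1 - \<alpha> \<le> \<alpha>\<close>, so the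
      mass sent from \<open>x\<close> to \<open>y\<close> fits into the idle mass at
      \<open>y\<close>. It has to stay there, as the potential is not tight for transport from
      \<open>y\<close> to \<open>x\<close>.\<close>
    have "pmf ?\<mu> y = (1 - \<alpha>) * walk_prob E w x y" "pmf ?\<nu> y = \<alpha>"
      using neq edge by (auto simp: Wx(1) Wy(1) neighbours_def)
    then show "pmf ?\<mu> y \<le> pmf ?\<nu> y" "pmf ?\<mu> y < 1"
      using le1 \<alpha> by argo+
    show "real (graph_dist E a b) = f a - f b"
      if "a \<in> set_pmf ?\<mu>" "b \<in> set_pmf ?\<nu>" "a \<noteq> y" for a b
    proof -
      have a: "a = x \<or> a \<in> neighbours E x \<and> a \<noteq> y"
        and b: "b = y \<or> b = x \<or> b \<in> neighbours E y \<and> b \<noteq> x"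
        using that Wx(2) Wy(2) by auto
      have "graph_dist E a x = 1" if "a \<in> neighbours E x"
        using that dist_1[of a x] by (simp add: neighbours_def insert_commute)
      moreover have "graph_dist E a y = 2" if "a \<in> neighbours E x" "a \<noteq> y"
      proof -
        have "walk_between E a [a, x, y] y" "a \<noteq> y" "{a, y} \<notin> E"
          using that edge no_triangle
          by (auto simp: walk_between_def neighbours_def insert_commute)
        then show ?thesis
          using graph_dist_le[of E a "[a, x, y]" y] graph_dist_ge_2[of E a "[a, x, y]" y] by simp
      qed
      moreover have "graph_dist E a b = 3" if "a \<in> neighbours E x" "a \<noteq> y" "b \<in> neighbours E y" "b \<noteq> x"
        using that dist_3 by (simp add: neighbours_def)
      moreover have "graph_dist E x b = 2" if "b \<in> neighbours E y" "b \<noteq> x"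
        using that dist_2 by (simp add: neighbours_def)
      ultimately show ?thesis
        using a b fu[of a] fv[of b] fx fy dist_1[OF edge] graph_dist_self[of E x] by auto
    qed
    show "f y - f b \<le> real (graph_dist E y b)" if "b \<in> set_pmf ?\<nu>" for b
    proof -
      have "b = y \<or> b \<in> neighbours E y"
        using that Wy(2) by auto
      then show ?thesis
        using fv[of b] fy dist_1[of y b] by (auto simp: neighbours_def)
    qed
    show "real (graph_dist E y y) = 0"
      by (simp add: graph_dist_self)
  qed
  also have "measure_pmf.expectation ?\<mu> f = \<alpha> + (1 - \<alpha>) * (2 - 2 * walk_prob E w x y)"
  proof -
    \<comment> \<open>On the neighbours of \<open>x\<close> the potential is 2 except at
      \<open>y\<close>, where it is 0; the exception is written as a delta term, so that the rest
      sums to total probability 1.\<close>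
    have "(\<Sum>u\<in>neighbours E x. walk_prob E w x u * f u) =
        (\<Sum>u\<in>neighbours E x. 2 * walk_prob E w x u - 2 * (if y = u then walk_prob E w x u else 0))"
      by (rule sum.cong) (auto simp: fu)
    also have "\<dots> = 2 - 2 * walk_prob E w x y"
      using fin(1) edge sum_walk_prob[of E w x] walk_prob_bounds(1)[where w = w, OF fin(1) pos edge]
      by (simp add: sum_subtractf sum_distrib_left[symmetric] neighbours_def)
    finally show ?thesis
      by (simp add: Wx(3) fx)
  qed
  also have "measure_pmf.expectation ?\<nu> f = (1 - \<alpha>) * (2 * walk_prob E w y x - 1)"
  proof -
    have "(\<Sum>u\<in>neighbours E y. walk_prob E w y u * f u) =
        (\<Sum>u\<in>neighbours E y. 2 * (if x = u then walk_prob E w y u else 0) - walk_prob E w y u)"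
      by (rule sum.cong) (auto simp: fv)
    also have "\<dots> = 2 * walk_prob E w y x - 1"
      using fin(2) swap.edge sum_walk_prob[of E w y] walk_prob_bounds(1)[where w = w, OF fin(2) pos swap.edge]
      by (simp add: sum_subtractf sum_distrib_left[symmetric] neighbours_def)
    finally show ?thesis
      by (simp add: Wy(3) fy)
  qed
  finally show ?thesis
    by (simp add: algebra_simps)
qed

text \<open>By the transport formula and \<open>graph_dist E x y = 1\<close>, the quotient does not
  depend on \<open>\<alpha>\<close> in (1/2, 1), so the limit at 1 is its constant value.\<close>

lemma lly_curvature_eq:
  assumes fin: "finite (neighbours E x)" "finite (neighbours E y)"
    and pos: "\<And>e. e \<in> E \<Longrightarrow> 0 < w e"
  shows "lly_curvature E w x y = 2 * (walk_prob E w x y + walk_prob E w y x) - 2"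
  unfolding lly_curvature_def
proof (rule tendsto_Lim)
  have "eventually (\<lambda>\<alpha>::real. \<alpha> \<in> {1 / 2<..<1}) (at_left 1)"
    by (rule eventually_at_left_real) simp
  then have "eventually (\<lambda>\<alpha>. ollivier_curvature E w \<alpha> x y / (1 - \<alpha>) =
      2 * (walk_prob E w x y + walk_prob E w y x) - 2) (at_left 1)"
  proof eventually_elim
    case (elim \<alpha>)
    then show ?case
      using wasserstein_lazy_walk[where w = w and \<alpha> = \<alpha>, OF fin pos] dist_1[OF edge]
      by (simp add: ollivier_curvature_def)
  qed
  then show "((\<lambda>\<alpha>. ollivier_curvature E w \<alpha> x y / (1 - \<alpha>)) \<longlongrightarrow>
      2 * (walk_prob E w x y + walk_prob E w y x) - 2) (at_left 1)"
    by (rule tendsto_eventually)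
qed (rule trivial_limit_at_left_real)

end

section \<open>Uniqueness of the flow\<close>

text \<open>Numerator and denominator each change by at most the factor \<open>exp \<delta>\<close>,
  the denominator because it is a sum of weights with that property. The ratio thus changes by at
  most \<open>exp (2 * \<delta>)\<close>, however many neighbours there are.\<close>

lemma walk_prob_diff_le:
  assumes fin: "finite (neighbours E x)" and edge: "{x, y} \<in> E"
    and pos: "\<And>e. e \<in> E \<Longrightarrow> 0 < w1 e" "\<And>e. e \<in> E \<Longrightarrow> 0 < w2 e"
    and close: "\<And>e. e \<in> E \<Longrightarrow> \<bar>ln (w1 e) - ln (w2 e)\<bar> \<le> \<delta>"
  shows "walk_prob E w2 x y - walk_prob E w1 x y \<le> 2 * \<delta>"
proof -
  have le: "w2 e \<le> exp \<delta> * w1 e" "w1 e \<le> exp \<delta> * w2 e" if "e \<in> E" for e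
  proof -
    have "exp (ln (w2 e)) \<le> exp (\<delta> + ln (w1 e))" "exp (ln (w1 e)) \<le> exp (\<delta> + ln (w2 e))"
      using close[OF that] by auto
    then show "w2 e \<le> exp \<delta> * w1 e" "w1 e \<le> exp \<delta> * w2 e"
      using pos that by (auto simp: exp_add)
  qed
  note P1 = walk_prob_bounds[where w = w1, OF fin pos(1) edge]
  note P2 = walk_prob_bounds[where w = w2, OF fin pos(2) edge]
  have "vertex_weight E w1 x \<le> exp \<delta> * vertex_weight E w2 x"
    unfolding vertex_weight_def sum_distrib_left
    by (rule sum_mono) (use le in \<open>auto simp: neighbours_def\<close>)
  moreover have "w2 {x, y} \<le> exp \<delta> * w1 {x, y}"
    using le edge by auto
  ultimately have "w2 {x, y} * vertex_weight E w1 x \<le>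
      (exp \<delta> * w1 {x, y}) * (exp \<delta> * vertex_weight E w2 x)"
    by (intro mult_mono) (use pos edge P1 in \<open>auto simp: less_imp_le\<close>)
  then have "walk_prob E w2 x y \<le> exp \<delta> * exp \<delta> * walk_prob E w1 x y"
    using P1(1) P2(1) by (simp add: walk_prob_def field_simps)
  also have "exp \<delta> * exp \<delta> = exp (2 * \<delta>)"
    by (simp add: exp_add[symmetric])
  \<comment> \<open>With the exponential on this side, the error is
    \<open>1 - exp (- (2 * \<delta>))\<close>, which is at most \<open>2 * \<delta>\<close> for
    every \<open>\<delta>\<close>; the factor \<open>exp (2 * \<delta>) - 1\<close> admits no such
    linear bound for large \<open>\<delta>\<close>.\<close>
  finally have "exp (- (2 * \<delta>)) * walk_prob E w2 x y \<le> walk_prob E w1 x y"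
    by (simp add: exp_minus field_simps)
  moreover have "(1 - exp (- (2 * \<delta>))) * walk_prob E w2 x y \<le> 2 * \<delta>"
  proof -
    have "0 \<le> \<delta>"
      using close[OF edge] by linarith
    then have "(1 - exp (- (2 * \<delta>))) * walk_prob E w2 x y \<le> 1 - exp (- (2 * \<delta>))"
      using P2 by (intro mult_left_le) auto
    also have "\<dots> \<le> 2 * \<delta>"
      using exp_ge_add_one_self[of "- (2 * \<delta>)"] by simp
    finally show ?thesis .
  qed
  ultimately show ?thesis
    by (simp add: algebra_simps)
qed

section \<open>Comparison and iteration for infinite families of functions\<close>

lemma abs_le_of_deriv_le:
  fixes v g :: "real \<Rightarrow> real"
  assumes "0 \<le> t" "continuous_on {0..t} v" "continuous_on {0..t} g" "v 0 = 0" "g 0 = 0"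
    and v: "\<And>s. 0 < s \<Longrightarrow> s < t \<Longrightarrow> (v has_real_derivative v' s) (at s)"
    and g: "\<And>s. 0 < s \<Longrightarrow> s < t \<Longrightarrow> (g has_real_derivative g' s) (at s)"
    and le: "\<And>s. 0 < s \<Longrightarrow> s < t \<Longrightarrow> \<bar>v' s\<bar> \<le> g' s"
  shows "\<bar>v t\<bar> \<le> g t"
proof -
  \<comment> \<open>Both \<open>g - v\<close> and \<open>g + v\<close> are nondecreasing.
    Derivatives are used in the open interval only, in line with a flow equation that holds for
    positive times.\<close>
  have "g 0 - v 0 \<le> g t - v t"
  proof (rule DERIV_nonneg_imp_increasing_open[OF \<open>0 \<le> t\<close>])
    fix s assume s: "0 < s" "s < t"
    show "\<exists>z. ((\<lambda>s. g s - v s) has_real_derivative z) (at s) \<and> 0 \<le> z"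
      using DERIV_diff[OF g[OF s] v[OF s]] le[OF s] by (intro exI[of _ "g' s - v' s"]) auto
  qed (use assms in \<open>auto intro!: continuous_intros\<close>)
  moreover have "g 0 + v 0 \<le> g t + v t"
  proof (rule DERIV_nonneg_imp_increasing_open[OF \<open>0 \<le> t\<close>])
    fix s assume s: "0 < s" "s < t"
    show "\<exists>z. ((\<lambda>s. g s + v s) has_real_derivative z) (at s) \<and> 0 \<le> z"
      using DERIV_add[OF g[OF s] v[OF s]] le[OF s] by (intro exI[of _ "g' s + v' s"]) auto
  qed (use assms in \<open>auto intro!: continuous_intros\<close>)
  ultimately show ?thesis
    using assms(4,5) by linarith
qed

text \<open>The uniform bound \<open>B\<close> on the derivatives starts an iteration, and each
  integration of the Lipschitz estimate gains a factor \<open>L * s / n\<close>. All estimates are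
  pointwise with a common right-hand side, so no supremum over \<open>S\<close> has to be integrated
  or differentiated.\<close>

lemma picard_zero:
  fixes v v' :: "'e \<Rightarrow> real \<Rightarrow> real"
  assumes cont: "\<And>e. e \<in> S \<Longrightarrow> continuous_on {0..} (v e)"
    and init: "\<And>e. e \<in> S \<Longrightarrow> v e 0 = 0"
    and deriv: "\<And>e t. e \<in> S \<Longrightarrow> 0 < t \<Longrightarrow> (v e has_real_derivative v' e t) (at t)"
    and bound: "\<And>e t. e \<in> S \<Longrightarrow> 0 < t \<Longrightarrow> \<bar>v' e t\<bar> \<le> B"
    and lip: "\<And>e t \<delta>. e \<in> S \<Longrightarrow> 0 < t \<Longrightarrow> (\<And>f. f \<in> S \<Longrightarrow> \<bar>v f t\<bar> \<le> \<delta>) \<Longrightarrow> \<bar>v' e t\<bar> \<le> L * \<delta>"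
    and e: "e \<in> S" and t: "0 \<le> t"
  shows "v e t = 0"
proof -
  have cont': "continuous_on {0..s} (v e)" if "e \<in> S" for e s
    using cont[OF that] by (rule continuous_on_subset) auto
  have B: "0 \<le> B"
    using bound[OF e, of 1] by linarith
  \<comment> \<open>The horizon \<open>t\<close> is fixed, and \<open>B * t\<close> bounds every
    member of the family on \<open>[0, t]\<close>. The induction generalises over the index and the
    time, since one step for one index uses the previous bound for all indices at earlier
    times.\<close>
  have iter: "\<bar>v e s\<bar> \<le> B * t * ((L * s) ^ n / fact n)" if "e \<in> S" "0 \<le> s" "s \<le> t" for e s n
    using that
  proof (induction n arbitrary: e s)
    case 0
    have "\<bar>v e s\<bar> \<le> B * s"
      by (rule abs_le_of_deriv_le[where v = "v e" and g = "\<lambda>s. B * s" and v' = "v' e" and g' = "\<lambda>_. B"])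
        (use 0 init deriv bound cont' in \<open>auto intro!: continuous_intros derivative_eq_intros\<close>)
    also have "\<dots> \<le> B * t"
      using 0 B by (intro mult_left_mono) auto
    finally show ?case
      by simp
  next
    case (Suc n)
    show ?case
    proof (rule abs_le_of_deriv_le[where v = "v e" and v' = "v' e"
          and g = "\<lambda>s. B * t * ((L * s) ^ Suc n / fact (Suc n))"
          and g' = "\<lambda>s. L * (B * t * ((L * s) ^ n / fact n))"])
      fix r assume r: "0 < r" "r < s"
      show "\<bar>v' e r\<bar> \<le> L * (B * t * ((L * r) ^ n / fact n))"
        by (rule lip) (use Suc r in auto)
      show "((\<lambda>s. B * t * ((L * s) ^ Suc n / fact (Suc n))) has_real_derivative
          L * (B * t * ((L * r) ^ n / fact n))) (at r)"
      proof (rule DERIV_cong)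
        have "((\<lambda>s. (L * s) ^ Suc n) has_real_derivative (1 + real n) * (L * (L * r) ^ n)) (at r)"
          by (rule DERIV_power_Suc) (auto intro!: derivative_eq_intros)
        then show "((\<lambda>s. B * t * ((L * s) ^ Suc n / fact (Suc n))) has_real_derivative
            B * t * ((1 + real n) * (L * (L * r) ^ n) / fact (Suc n))) (at r)"
          by (intro DERIV_cmult DERIV_cdivide)
        have "(1 + real n) * (L * (L * r) ^ n) / fact (Suc n) = L * ((L * r) ^ n / fact n)"
          by (simp add: divide_simps)
        then show "B * t * ((1 + real n) * (L * (L * r) ^ n) / fact (Suc n)) =
            L * (B * t * ((L * r) ^ n / fact n))"
          by simp
      qed
    qed (use Suc.prems init deriv cont' in \<open>auto intro!: continuous_intros\<close>)
  qed
  \<comment> \<open>These are, up to the constant \<open>B * t\<close>, the terms of the convergent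
    exponential series at \<open>L * t\<close>.\<close>
  have "(\<lambda>n. B * t * ((L * t) ^ n / fact n)) \<longlonglongrightarrow> B * t * 0"
    using summable_LIMSEQ_zero[OF summable_exp[of "L * t"]]
    by (intro tendsto_mult tendsto_const) (simp add: field_simps)
  then have "\<bar>v e t\<bar> \<le> B * t * 0"
    by (rule LIMSEQ_le_const) (use iter[OF e t order_refl] in blast)
  then show ?thesis
    by simp
qed

theorem theorem1p3:
  fixes V :: "'a set" and E :: "'a set set"
    and \<kappa>s \<omega>0 :: "'a set \<Rightarrow> real"
    and \<omega>1 \<omega>2 :: "real \<Rightarrow> 'a set \<Rightarrow> real"
  assumes "simple_graph V E"
    and "infinite V"
    and "connected_graph V E"
    and "locally_finite_graph V E"
    and "girth E \<ge> 6"
    and "\<forall>e\<in>E. 0 < \<omega>0 e"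
    and "ricci_flow_solution E \<kappa>s \<omega>0 \<omega>1"
    and "ricci_flow_solution E \<kappa>s \<omega>0 \<omega>2"
  shows "\<forall>e\<in>E. \<forall>t\<ge>0. \<omega>1 t e = \<omega>2 t e"
proof (intro ballI allI impI)
  fix e0 and t0 :: real assume "e0 \<in> E" "0 \<le> t0"
  have loops: "{z} \<notin> E" for z
    using assms(1) unfolding simple_graph_def by (metis doubleton_eq_iff insert_absorb2)
  have ends: "\<exists>x y. e = {x, y}" if "e \<in> E" for e
    using assms(1) that unfolding simple_graph_def by blast
  have fin: "finite (neighbours E x)" if "{x, y} \<in> E" for x y
  proof -
    have "x \<in> V"
      using assms(1) that unfolding simple_graph_def by (metis doubleton_eq_iff)
    then show ?thesis
      using assms(4) by (simp add: locally_finite_graph_def)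
  qed
  have pos1: "0 < \<omega>1 t e" and pos2: "0 < \<omega>2 t e" if "e \<in> E" "0 \<le> t" for t e
    using assms(7,8) that by (auto simp: ricci_flow_solution_def)

  \<comment> \<open>Curvature in terms of the unordered edge\<close>
  define P where "P w x y = walk_prob E w x y + walk_prob E w y x" for w x y
  have P_sym: "P w x y = P w y x" for w x y
    by (simp add: P_def)
  \<comment> \<open>\<open>P\<close> as a function of the unordered edge; only its values on pairs \<open>{x, y}\<close> matter.\<close>
  define Pe where "Pe w e = (THE p. \<exists>x y. e = {x, y} \<and> p = P w x y)" for w e
  have Pe: "Pe w {x, y} = P w x y" for w x y
    unfolding Pe_def by (rule the_equality) (auto simp: doubleton_eq_iff P_sym)
  have curv: "lly_curvature E w x y = 2 * P w x y - 2"
    if "{x, y} \<in> E" "\<And>e. e \<in> E \<Longrightarrow> 0 < w e" for w x y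
  proof -
    interpret girth_6_edge E x y
      by unfold_locales (use assms(5) loops that in auto)
    show ?thesis
      unfolding P_def using that fin[of x y] fin[of y x]
      by (intro lly_curvature_eq) (auto simp: insert_commute)
  qed
  have P_bounds: "0 \<le> P w x y" "P w x y \<le> 2"
    if "{x, y} \<in> E" "\<And>e. e \<in> E \<Longrightarrow> 0 < w e" for w x y
  proof -
    have "{y, x} \<in> E"
      using that by (simp add: insert_commute)
    then have "0 < walk_prob E w x y" "walk_prob E w x y \<le> 1"
      "0 < walk_prob E w y x" "walk_prob E w y x \<le> 1"
      using walk_prob_bounds[of E x w y] walk_prob_bounds[of E y w x] that fin by auto
    then show "0 \<le> P w x y" "P w x y \<le> 2"
      by (auto simp: P_def)
  qed
  \<comment> \<open>Each of the two directions of the edge contributes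
    \<open>2 * \<delta>\<close>.\<close>
  have P_diff: "P w2 x y - P w1 x y \<le> 4 * \<delta>"
    if "{x, y} \<in> E" "\<And>e. e \<in> E \<Longrightarrow> 0 < w1 e" "\<And>e. e \<in> E \<Longrightarrow> 0 < w2 e"
      "\<And>e. e \<in> E \<Longrightarrow> \<bar>ln (w1 e) - ln (w2 e)\<bar> \<le> \<delta>" for w1 w2 x y \<delta>
  proof -
    have e: "{y, x} \<in> E"
      using that by (simp add: insert_commute)
    show ?thesis
      using walk_prob_diff_le[where ?w1.0 = w1 and ?w2.0 = w2, OF fin[OF that(1)] that]
        walk_prob_diff_le[where ?w1.0 = w1 and ?w2.0 = w2, OF fin[OF e] e that(2-)]
      by (simp add: P_def)
  qed

  \<comment> \<open>The logarithmic difference of two solutions\<close>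
  define v where "v e t = ln (\<omega>1 t e) - ln (\<omega>2 t e)" for e t
  \<comment> \<open>Dividing the flow equation by the weight isolates
    \<open>\<kappa>s e + 2\<close>, which is the same for both solutions and cancels in
    \<open>v\<close>, however \<open>\<kappa>s\<close> varies over the edges.\<close>
  have deriv_ln: "((\<lambda>s. ln (\<omega> s e)) has_real_derivative \<kappa>s e + 2 - 2 * Pe (\<omega> t) e) (at t)"
    if sol: "ricci_flow_solution E \<kappa>s \<omega>0 \<omega>" and "e \<in> E" "0 < t" for \<omega> e t
  proof -
    obtain x y where e: "e = {x, y}"
      using ends \<open>e \<in> E\<close> by blast
    have pos: "0 < \<omega> t f" if "f \<in> E" for f
      using sol that \<open>0 < t\<close> by (auto simp: ricci_flow_solution_def)
    have "((\<lambda>s. \<omega> s e) has_real_derivative - (lly_curvature E (\<omega> t) x y - \<kappa>s e) * \<omega> t e) (at t)"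
      using sol that e by (auto simp: ricci_flow_solution_def)
    from DERIV_chain2[where f = ln, OF DERIV_ln_divide[OF pos[OF \<open>e \<in> E\<close>]] this] show ?thesis
    proof (rule DERIV_cong)
      have "lly_curvature E (\<omega> t) x y = 2 * Pe (\<omega> t) e - 2"
        using curv[of x y "\<omega> t"] pos \<open>e \<in> E\<close> by (simp add: e Pe)
      then show "1 / \<omega> t e * (- (lly_curvature E (\<omega> t) x y - \<kappa>s e) * \<omega> t e) =
          \<kappa>s e + 2 - 2 * Pe (\<omega> t) e"
        using pos[OF \<open>e \<in> E\<close>] by simp
    qed
  qed
  have "v e0 t0 = 0"
  \<comment> \<open>\<open>B = 4\<close> is twice the length of the interval \<open>[0, 2]\<close>
    containing \<open>P\<close>; \<open>L = 8\<close> is twice the constant in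
    \<open>P_diff\<close>. The solutions appear in reverse order in \<open>v'\<close> because the
    probabilities enter the logarithmic derivative with a minus sign.\<close>
  proof (rule picard_zero[where S = E and v = v and B = 4 and L = 8
        and v' = "\<lambda>e t. 2 * Pe (\<omega>2 t) e - 2 * Pe (\<omega>1 t) e"])
    fix e assume e: "e \<in> E"
    have "continuous_on {0..} (\<lambda>t. \<omega>1 t e)" "continuous_on {0..} (\<lambda>t. \<omega>2 t e)"
      using assms(7,8) e by (auto simp: ricci_flow_solution_def)
    then show "continuous_on {0..} (v e)"
      unfolding v_def by (intro continuous_intros) (use pos1 pos2 e in \<open>force+\<close>)
    show "v e 0 = 0"
      using assms(7,8) e by (auto simp: ricci_flow_solution_def v_def)
    obtain x y where xy: "e = {x, y}"
      using ends e by blast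
    fix t :: real assume t: "0 < t"
    show "(v e has_real_derivative 2 * Pe (\<omega>2 t) e - 2 * Pe (\<omega>1 t) e) (at t)"
      using DERIV_diff[OF deriv_ln[OF assms(7) e t] deriv_ln[OF assms(8) e t]]
      by (simp add: v_def[abs_def])
    show "\<bar>2 * Pe (\<omega>2 t) e - 2 * Pe (\<omega>1 t) e\<bar> \<le> 4"
      using P_bounds[of x y "\<omega>1 t"] P_bounds[of x y "\<omega>2 t"] pos1 pos2 e t by (auto simp: xy Pe)
    fix \<delta> assume \<delta>: "\<And>f. f \<in> E \<Longrightarrow> \<bar>v f t\<bar> \<le> \<delta>"
    then have \<delta>': "\<bar>ln (\<omega>1 t f) - ln (\<omega>2 t f)\<bar> \<le> \<delta>" "\<bar>ln (\<omega>2 t f) - ln (\<omega>1 t f)\<bar> \<le> \<delta>"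
      if "f \<in> E" for f
      using that by (auto simp: v_def abs_minus_commute)
    \<comment> \<open>The estimate is one-sided, so it is applied with the solutions in both
      orders.\<close>
    have "P (\<omega>2 t) x y - P (\<omega>1 t) x y \<le> 4 * \<delta>" "P (\<omega>1 t) x y - P (\<omega>2 t) x y \<le> 4 * \<delta>"
      by (rule P_diff; use \<delta>' pos1 pos2 e t xy in auto)+
    then show "\<bar>2 * Pe (\<omega>2 t) e - 2 * Pe (\<omega>1 t) e\<bar> \<le> 8 * \<delta>"
      by (simp add: xy Pe)
  qed (use \<open>e0 \<in> E\<close> \<open>0 \<le> t0\<close> in auto)
  then show "\<omega>1 t0 e0 = \<omega>2 t0 e0"
    using pos1[OF \<open>e0 \<in> E\<close> \<open>0 \<le> t0\<close>] pos2[OF \<open>e0 \<in> E\<close> \<open>0 \<le> t0\<close>] by (simp add: v_def)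
qed

end
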